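(* Let $G$ be a graph, $k=\mathrm{mw}_{37}(G)$ and $\ell=k\cdot\pi_G(k)$. Then $G$ admits a neighbourhood cover of overlap $\ell^2$ and radius $38$.
   Context: Graphs are finite, simple, undirected; $N(v)$ is the open neighbourhood and $\mathrm{Ball}^t_G(v)$ the set of vertices at distance at most $t$ from $v$ in $G$. $\pi_G(m)=\max_{A\subseteq V(G),|A|\le m}|\{N(v)\cap A:v\in V(G)\}|$. For a partition $\mathcal P$ of $V(G)$ and $X\subseteq V(G)$, $X/\mathcal P$ is the set of parts intersecting $X$. For $R\subseteq\binom{V(G)}2$, $\mathrm{Ball}^r_R(v)$ is the radius-$r$ ball in $(V(G),R)$. $\mathcal P$ is homogeneous modulo $R$ if for all parts $X,Y$ (possibly equal), the pairs $\{x,y\}$, $x\in X,y\in Y,x\ne y$, not in $R$ are all edges of $G$ or all non-edges. A merge sequence for $G$ is $(\mathcal P_1,R_1),\dots,(\mathcal P_m,R_m)$ with $\mathcal P_1\preceq\dots\preceq\mathcal P_m$ partitions of $V(G)$, $\mathcal P_1$ into singletons, $\mathcal P_m=\{V(G)\}$, $R_1\subseteq\dots\subseteq R_m$, $\mathcal P_t$ homogeneous modulo $R_t$; its radius-$r$ width is $\max_{t<m}\max_v|\mathrm{Ball}^r_{R_{t+1}}(v)/\mathcal P_t|$; $\mathrm{mw}_r(G)$ is the minimum. A neighbourhood cover of $G$ of overlap $k$ and radius $t$ is a family $\mathcal K$ of non-empty subsets of $V(G)$ such that (i) for every $v\in V(G)$ there is $C\in\mathcal K$ with $N(v)\subseteq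 C$; (ii) for every $C\in\mathcal K$ there is $v\in V(G)$ with $C\subseteq\mathrm{Ball}^t_G(v)$; (iii) every $v\in V(G)$ lies in at most $k$ sets of $\mathcal K$. *)

theory Defs
  imports "HOL-Library.Disjoint_Sets" "HOL-Library.Ramsey" "HOL-Library.Extended_Nat"
begin

definition finite_graph :: "'a set \<Rightarrow> 'a set set \<Rightarrow> bool" where
  "finite_graph V E \<longleftrightarrow> finite V \<and> E \<subseteq> [V]\<^bsup>2\<^esup>"

definition nbhd :: "'a set set \<Rightarrow> 'a \<Rightarrow> 'a set" where
  "nbhd E v = {u. {v, u} \<in> E}"

text \<open>The least length of a walk from \<open>u\<close> to \<open>v\<close>; it is \<open>\<infinity>\<close> if there is none.\<close>

definition graph_dist :: "'a set set \<Rightarrow> 'a \<Rightarrow> 'a \<Rightarrow> enat" where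
  "graph_dist E u v = (INF n \<in> {n. (u, v) \<in> {(x, y). {x, y} \<in> E} ^^ n}. enat n)"

definition graph_ball :: "'a set \<Rightarrow> 'a set set \<Rightarrow> nat \<Rightarrow> 'a \<Rightarrow> 'a set" where
  "graph_ball V E r v = {u \<in> V. graph_dist E v u \<le> enat r}"

definition nbhd_complexity :: "'a set \<Rightarrow> 'a set set \<Rightarrow> nat \<Rightarrow> nat" where
  "nbhd_complexity V E m =
     Max ((\<lambda>A. card ((\<lambda>v. nbhd E v \<inter> A) ` V)) ` {A. A \<subseteq> V \<and> card A \<le> m})"

definition parts_meeting :: "'a set \<Rightarrow> 'a set set \<Rightarrow> 'a set set" where
  "parts_meeting X P = {Y \<in> P. X \<inter> Y \<noteq> {}}"

definition homogeneous_mod :: "'a set set \<Rightarrow> 'a set set \<Rightarrow> 'a set set \<Rightarrow> bool" where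
  "homogeneous_mod E R P \<longleftrightarrow>
     (\<forall>X\<in>P. \<forall>Y\<in>P.
        (\<forall>x\<in>X. \<forall>y\<in>Y. x \<noteq> y \<and> {x, y} \<notin> R \<longrightarrow> {x, y} \<in> E) \<or>
        (\<forall>x\<in>X. \<forall>y\<in>Y. x \<noteq> y \<and> {x, y} \<notin> R \<longrightarrow> {x, y} \<notin> E))"

text \<open>The sequence is \<open>(P 1, R 1), \<dots>, (P m, R m)\<close>; values at other indices are irrelevant.\<close>

definition merge_sequence ::
  "'a set \<Rightarrow> 'a set set \<Rightarrow> nat \<Rightarrow> (nat \<Rightarrow> 'a set set) \<Rightarrow> (nat \<Rightarrow> 'a set set) \<Rightarrow> bool" where
  "merge_sequence V E m P R \<longleftrightarrow>
     1 \<le> m \<and>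
     (\<forall>t\<in>{1..m}. partition_on V (P t) \<and> R t \<subseteq> [V]\<^bsup>2\<^esup> \<and> homogeneous_mod E (R t) (P t)) \<and>
     (\<forall>t\<in>{1..<m}. refines V (P t) (P (t + 1)) \<and> R t \<subseteq> R (t + 1)) \<and>
     P 1 = (\<lambda>v. {v}) ` V \<and> P m = {V}"

definition merge_sequence_width ::
  "'a set \<Rightarrow> nat \<Rightarrow> nat \<Rightarrow> (nat \<Rightarrow> 'a set set) \<Rightarrow> (nat \<Rightarrow> 'a set set) \<Rightarrow> nat" where
  "merge_sequence_width V r m P R =
     Max ((\<lambda>(t, v). card (parts_meeting (graph_ball V (R (t + 1)) r v) (P t))) ` ({1..<m} \<times> V))"

text \<open>
  The condition \<open>2 \<le> m\<close> ensures that the maximum defining the width ranges over a non-empty set.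
  It excludes only the one-term sequence of a one-vertex graph, so that such a graph
  has merge-width 1. The minimum exists whenever \<open>V\<close> is finite and non-empty.
\<close>

definition merge_width :: "nat \<Rightarrow> 'a set \<Rightarrow> 'a set set \<Rightarrow> nat" where
  "merge_width r V E =
     Inf {merge_sequence_width V r m P R | m P R. merge_sequence V E m P R \<and> 2 \<le> m}"

definition neighbourhood_cover ::
  "'a set \<Rightarrow> 'a set set \<Rightarrow> nat \<Rightarrow> nat \<Rightarrow> 'a set set \<Rightarrow> bool" where
  "neighbourhood_cover V E k t K \<longleftrightarrow>
     (\<forall>C\<in>K. C \<noteq> {} \<and> C \<subseteq> V) \<and>
     (\<forall>v\<in>V. \<exists>C\<in>K. nbhd E v \<subseteq> C) \<and>
     (\<forall>C\<in>K. \<exists>v\<in>V. C \<subseteq> graph_ball V E t v) \<and>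
     (\<forall>v\<in>V. card {C\<in>K. v \<in> C} \<le> k)"

lemma merge_sequence_exists:
  assumes "V \<noteq> {}"
  shows "\<exists>P R. merge_sequence V E 2 P R"
proof -
  have "merge_sequence V E 2 (\<lambda>t. if t = 1 then (\<lambda>v. {v}) ` V else {V}) (\<lambda>t. [V]\<^bsup>2\<^esup>)"
    using assms
    by (auto simp: merge_sequence_def homogeneous_mod_def partition_on_def disjoint_def refines_def)
  then show ?thesis by blast
qed

lemma merge_width_attained:
  assumes "V \<noteq> {}"
  shows "\<exists>m P R. merge_sequence V E m P R \<and> 2 \<le> m \<and>
           merge_sequence_width V r m P R = merge_width r V E"
proof -
  let ?S = "{merge_sequence_width V r m P R | m P R. merge_sequence V E m P R \<and> 2 \<le> m}"
  have "?S \<noteq> {}" using merge_sequence_exists[OF assms] by fastforce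
  then have "Inf ?S \<in> ?S" by (rule Inf_nat_def1)
  then show ?thesis unfolding merge_width_def by (smt (verit, best) mem_Collect_eq)
qed

end

theory Submission
  imports Defs
begin

text \<open>
  Fix an optimal merge sequence. Label every edge \<open>xy\<close> by the last time \<open>s\<close> at which the parts
  \<open>X \<ni> x\<close>, \<open>Y \<ni> y\<close> of \<open>P s\<close> are completely adjacent modulo \<open>R s\<close> while \<open>X \<union> Y\<close> lies in no
  \<open>R s\<close>-ball of radius 4, together with \<open>X\<close> and \<open>Y\<close>. Being spread out forces the edges
  with a given label to cluster in \<open>G\<close> around at most two vertices, while after time \<open>s\<close> the edge
  \<open>xy\<close> has its ends at \<open>R\<close>-distance at most 8. Each vertex \<open>v\<close> picks the latest label among the
  edges \<open>xy\<close> with \<open>x \<in> N(v)\<close>, and the neighbourhoods of all vertices with the same label and the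
  same centre form one cluster.

  To bound the overlap at \<open>u\<close>, let \<open>s\<close> be the earliest label time over \<open>v \<in> N(u)\<close>. At time
  \<open>s + 1\<close> all of \<open>N(u)\<close> is \<open>R\<close>-close to \<open>u\<close>. If \<open>v\<close> picked \<open>xy\<close> with \<open>x\<close> far from \<open>u\<close>, homogeneity
  makes \<open>x\<close> a neighbour of every other \<open>v' \<in> N(u)\<close> in the part of \<open>v\<close>, so the label depends only on
  that part; if \<open>x\<close> is near and \<open>y\<close> far, it depends only on the part of \<open>x\<close>; if both are near, on the
  parts of \<open>x\<close> and \<open>y\<close>. As at most \<open>k\<close> parts are near \<open>u\<close>, this leaves at most \<open>2k\<^sup>2\<close> labels,
  hence \<open>4k\<^sup>2\<close> clusters, and \<open>\<pi>(k) \<ge> 2\<close> as soon as there is an edge.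
\<close>

section \<open>Distance balls described by walks of bounded length\<close>

lemma relpow_sym: "sym r \<Longrightarrow> sym (r ^^ n)"
proof (induction n)
  case 0
  then show ?case by (simp add: sym_Id)
next
  case (Suc n)
  show ?case
  proof (rule symI)
    fix a b assume "(a, b) \<in> r ^^ Suc n"
    then obtain c where "(a, c) \<in> r ^^ n" "(c, b) \<in> r" by auto
    then have "(c, a) \<in> r ^^ n" "(b, c) \<in> r"
      using Suc by (auto dest: symD)
    then show "(b, a) \<in> r ^^ Suc n" by (rule relpow_Suc_I2[rotated])
  qed
qed

text \<open>An infimum in \<open>enat\<close> that is at most \<open>r\<close> is finite, so its
  index set is non-empty, and by well-ordering it is attained by an actual walk.\<close>

lemma mem_graph_ball_iff:
  "u \<in> graph_ball V E r v \<longleftrightarrow> u \<in> V \<and> (\<exists>n\<le>r. (v, u) \<in> {(x, y). {x, y} \<in> E} ^^ n)"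
proof -
  let ?S = "{n. (v, u) \<in> {(x, y). {x, y} \<in> E} ^^ n}"
  have "(INF n\<in>?S. enat n) \<le> enat r \<longleftrightarrow> (\<exists>n\<le>r. n \<in> ?S)"
  proof
    assume le: "(INF n\<in>?S. enat n) \<le> enat r"
    then have "enat ` ?S \<noteq> {}"
      by (metis Inf_empty enat.distinct(1) top_enat_def top.extremum_uniqueI)
    then have "Inf (enat ` ?S) \<in> enat ` ?S"
      by (meson ex_in_conv wellorder_InfI)
    then show "\<exists>n\<le>r. n \<in> ?S" using le by auto
  next
    assume "\<exists>n\<le>r. n \<in> ?S"
    then obtain n where "n \<le> r" "n \<in> ?S" by blast
    then show "(INF n\<in>?S. enat n) \<le> enat r"
      by (meson INF_lower2 enat_ord_simps(1))
  qed
  then show ?thesis by (simp add: graph_ball_def graph_dist_def)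
qed

lemma graph_ball_self: "v \<in> V \<Longrightarrow> v \<in> graph_ball V E r v"
  unfolding mem_graph_ball_iff by (metis le0 relpow_0_I)

lemma graph_ball_edge: "{v, u} \<in> E \<Longrightarrow> u \<in> V \<Longrightarrow> u \<in> graph_ball V E 1 v"
  unfolding mem_graph_ball_iff by (intro conjI exI[of _ 1]) auto

lemma graph_ball_sym:
  assumes "u \<in> graph_ball V E r v" "v \<in> V"
  shows "v \<in> graph_ball V E r u"
proof -
  have "sym {(x, y). {x, y} \<in> E}"
    by (auto intro: symI simp: insert_commute)
  then show ?thesis
    using assms unfolding mem_graph_ball_iff by (meson relpow_sym symD)
qed

lemma graph_ball_trans:
  assumes "u \<in> graph_ball V E r v" "w \<in> graph_ball V E s u"
  shows "w \<in> graph_ball V E (r + s) v"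
proof -
  obtain n n' where "n \<le> r" "n' \<le> s" "(v, u) \<in> {(x, y). {x, y} \<in> E} ^^ n"
      "(u, w) \<in> {(x, y). {x, y} \<in> E} ^^ n'"
    using assms unfolding mem_graph_ball_iff by blast
  then have "(v, w) \<in> {(x, y). {x, y} \<in> E} ^^ (n + n')" "n + n' \<le> r + s"
    by (auto simp: relpow_add)
  then show ?thesis using assms unfolding mem_graph_ball_iff by blast
qed

lemma graph_ball_mono:
  assumes "E \<subseteq> E'" "r \<le> r'"
  shows "graph_ball V E r v \<subseteq> graph_ball V E' r' v"
proof -
  have "{(x, y). {x, y} \<in> E} ^^ n \<subseteq> {(x, y). {x, y} \<in> E'} ^^ n" for n
    using assms(1) by (induction n) auto
  then show ?thesis
    using assms(2) unfolding subset_iff mem_graph_ball_iff by (meson order_trans)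
qed

lemma graph_ball_empty: "graph_ball V {} r v \<subseteq> {v}"
proof
  fix u assume "u \<in> graph_ball V {} r v"
  then obtain n where "(v, u) \<in> {(x, y). {x, y} \<in> ({} :: 'a set set)} ^^ n"
    unfolding mem_graph_ball_iff by blast
  then show "u \<in> {v}" by (cases n) auto
qed

section \<open>Counting by classes and breaking ties\<close>

lemma card_image_le_card_classes:
  assumes "finite C" "g ` S \<subseteq> C"
    and "\<And>v v'. v \<in> S \<Longrightarrow> v' \<in> S \<Longrightarrow> g v = g v' \<Longrightarrow> f v = f v'"
  shows "finite (f ` S) \<and> card (f ` S) \<le> card C"
proof -
  have "f v = f (inv_into S g (g v))" if "v \<in> S" for v
    using assms(3) that by (metis f_inv_into_f image_eqI inv_into_into)
  then have "f ` S \<subseteq> (\<lambda>c. f (inv_into S g c)) ` C"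
    using assms(2) by auto
  then show ?thesis
    using assms(1) by (meson card_image_le card_mono finite_imageI finite_subset le_trans)
qed

text \<open>An injective numbering \<open>g\<close> of \<open>S\<close> below \<open>n\<close> gives
  the rank \<open>h a * n + g a\<close>, which codes the lexicographic order of the pairs
  \<open>(h a, g a)\<close>.\<close>

lemma exists_injective_rank_refining:
  fixes h :: "'l \<Rightarrow> nat"
  assumes "finite S"
  obtains rank :: "'l \<Rightarrow> nat" where "inj_on rank S"
    "\<And>a b. a \<in> S \<Longrightarrow> b \<in> S \<Longrightarrow> rank a \<le> rank b \<Longrightarrow> h a \<le> h b"
proof -
  obtain g n where g: "g ` S = {i::nat. i < n}" "inj_on g S"
    using finite_imp_inj_to_nat_seg[OF assms] by blast
  define rank where "rank a = h a * n + g a" for a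
  have less: "rank a < rank b" if "a \<in> S" "b \<in> S" "h a < h b" for a b
  proof -
    have "g a < n" using g that by blast
    moreover have "Suc (h a) * n \<le> h b * n" using that by (intro mult_le_mono1) simp
    ultimately show ?thesis unfolding rank_def by simp
  qed
  have "inj_on rank S"
  proof (rule inj_onI)
    fix a b assume ab: "a \<in> S" "b \<in> S" "rank a = rank b"
    then have "h a = h b" using less by (metis less_irrefl linorder_neqE_nat)
    then have "g a = g b" using ab by (simp add: rank_def)
    then show "a = b" using g(2) ab by (meson inj_onD)
  qed
  then show ?thesis using that less by (meson leD leI)
qed

section \<open>Parts, spread pairs and edge labels\<close>

text \<open>The radius is 17 = 16 + 1: the counting argument cuts near from far at radius 16 around
  a vertex and leaves a margin of one step.\<close>

locale graph_merge_sequence =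
  fixes V :: "'a set" and E :: "'a set set" and m k :: nat and P R :: "nat \<Rightarrow> 'a set set"
  assumes graph: "finite_graph V E"
    and seq: "merge_sequence V E m P R"
    and R_1: "R 1 = {}"
    and width: "\<And>t v. t \<in> {1..<m} \<Longrightarrow> v \<in> V \<Longrightarrow>
          card (parts_meeting (graph_ball V (R (t + 1)) 17 v) (P t)) \<le> k"
begin

abbreviation rball :: "nat \<Rightarrow> nat \<Rightarrow> 'a \<Rightarrow> 'a set" where
  "rball t r v \<equiv> graph_ball V (R t) r v"

text \<open>For \<open>t\<close> in \<open>{1..m}\<close> at most one part contains
  \<open>x\<close>, so the union is that part; it is empty for \<open>x\<close> outside
  \<open>V\<close>.\<close>

definition part :: "nat \<Rightarrow> 'a \<Rightarrow> 'a set" where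
  "part t x = \<Union>{X \<in> P t. x \<in> X}"

definition positive_pair :: "nat \<Rightarrow> 'a set \<Rightarrow> 'a set \<Rightarrow> bool" where
  "positive_pair t X Y \<longleftrightarrow> (\<forall>x\<in>X. \<forall>y\<in>Y. x \<noteq> y \<and> {x, y} \<notin> R t \<longrightarrow> {x, y} \<in> E)"

definition spread_pair :: "nat \<Rightarrow> 'a set \<Rightarrow> 'a set \<Rightarrow> bool" where
  "spread_pair t X Y \<longleftrightarrow> positive_pair t X Y \<and> \<not> (\<exists>z\<in>V. X \<union> Y \<subseteq> rball t 4 z)"

definition last_spread :: "'a \<Rightarrow> 'a \<Rightarrow> nat" where
  "last_spread x y = Max {t \<in> {1..m}. spread_pair t (part t x) (part t y)}"

definition label :: "'a \<Rightarrow> 'a \<Rightarrow> nat \<times> 'a set \<times> 'a set" where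
  "label x y = (last_spread x y, part (last_spread x y) x, part (last_spread x y) y)"

lemma finite_V: "finite V"
  using graph by (simp add: finite_graph_def)

lemma edge_in_V:
  assumes "{x, y} \<in> E"
  shows "x \<in> V \<and> y \<in> V \<and> x \<noteq> y"
proof -
  have "{x, y} \<in> [V]\<^bsup>2\<^esup>" using graph assms unfolding finite_graph_def by blast
  then show ?thesis by (auto simp: nsets_def)
qed

lemma partition: "t \<in> {1..m} \<Longrightarrow> partition_on V (P t)"
  and homogeneous: "t \<in> {1..m} \<Longrightarrow> homogeneous_mod E (R t) (P t)"
  and m_pos: "1 \<le> m"
  and P_1: "P 1 = (\<lambda>v. {v}) ` V"
  and P_m: "P m = {V}"
  using seq by (auto simp: merge_sequence_def)

lemma R_mono:
  assumes "t \<le> t'"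
  shows "1 \<le> t \<Longrightarrow> t' \<le> m \<Longrightarrow> R t \<subseteq> R t'"
  using assms
proof (induction t' rule: dec_induct)
  case (step n)
  then have "R n \<subseteq> R (n + 1)" using seq by (auto simp: merge_sequence_def)
  then show ?case using step by auto
qed simp

lemma part_eqI:
  assumes "t \<in> {1..m}" "X \<in> P t" "x \<in> X"
  shows "part t x = X"
proof -
  have "{Y \<in> P t. x \<in> Y} = {X}"
    using partition[OF assms(1)] assms(2,3) by (auto simp: partition_on_def disjoint_def)
  then show ?thesis by (simp add: part_def)
qed

lemma part_in_P: "t \<in> {1..m} \<Longrightarrow> x \<in> V \<Longrightarrow> part t x \<in> P t"
  and part_self: "t \<in> {1..m} \<Longrightarrow> x \<in> V \<Longrightarrow> x \<in> part t x"
  and part_subset: "t \<in> {1..m} \<Longrightarrow> part t x \<subseteq> V"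
proof -
  show "part t x \<in> P t" if "t \<in> {1..m}" "x \<in> V"
    using part_eqI[OF that(1)] partition[OF that(1)] that(2)
    unfolding partition_on_def by (metis UnionE)
  show "x \<in> part t x" if "t \<in> {1..m}" "x \<in> V"
    using part_eqI[OF that(1)] partition[OF that(1)] that(2)
    unfolding partition_on_def by (metis UnionE)
  show "part t x \<subseteq> V" if "t \<in> {1..m}"
    using partition[OF that] unfolding partition_on_def part_def by blast
qed

lemma part_mono:
  assumes "t \<le> t'" "x \<in> V" "y \<in> V" "part t x = part t y"
  shows "1 \<le> t \<Longrightarrow> t' \<le> m \<Longrightarrow> part t' x = part t' y"
  using assms(1)
proof (induction t' rule: dec_induct)
  case (step n)
  then have n: "n \<in> {1..m}" "Suc n \<in> {1..m}" "part n x = part n y" by auto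
  have "refines V (P n) (P (Suc n))" using seq step by (auto simp: merge_sequence_def)
  then obtain Y where Y: "Y \<in> P (Suc n)" "part n x \<subseteq> Y"
    using part_in_P[OF n(1) assms(2)] by (auto simp: refines_def)
  moreover have "x \<in> part n x" "y \<in> part n x"
    using part_self[OF n(1)] assms n(3) by auto
  ultimately show ?case using part_eqI[OF n(2)] by (metis subsetD)
qed (use assms in simp)

text \<open>As \<open>R 1\<close> is empty, no ball at time 1 contains both ends of an edge. Hence
  the maximum in \<open>last_spread\<close> ranges over a non-empty set.\<close>

lemma spread_pair_singletons:
  assumes "{x, y} \<in> E"
  shows "spread_pair 1 (part 1 x) (part 1 y)"
proof -
  have xy: "x \<in> V" "y \<in> V" "x \<noteq> y" using edge_in_V assms by auto
  then have "part 1 x = {x}" "part 1 y = {y}"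
    using m_pos P_1 by (intro part_eqI; simp)+
  moreover have "\<not> {x, y} \<subseteq> rball 1 4 z" for z
    using xy graph_ball_empty[of V 4 z] unfolding R_1 by blast
  ultimately show ?thesis
    using assms unfolding spread_pair_def positive_pair_def by fastforce
qed

lemma last_spread:
  assumes "{x, y} \<in> E"
  shows "last_spread x y \<in> {1..m}"
    and "spread_pair (last_spread x y) (part (last_spread x y) x) (part (last_spread x y) y)"
    and "t \<in> {1..m} \<Longrightarrow> spread_pair t (part t x) (part t y) \<Longrightarrow> t \<le> last_spread x y"
proof -
  let ?S = "{t \<in> {1..m}. spread_pair t (part t x) (part t y)}"
  have "1 \<in> ?S" using spread_pair_singletons[OF assms] m_pos by simp
  then have "Max ?S \<in> ?S" by (intro Max_in) auto
  then show "last_spread x y \<in> {1..m}"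
    "spread_pair (last_spread x y) (part (last_spread x y) x) (part (last_spread x y) y)"
    by (auto simp: last_spread_def)
  show "t \<in> {1..m} \<Longrightarrow> spread_pair t (part t x) (part t y) \<Longrightarrow> t \<le> last_spread x y"
    unfolding last_spread_def by (intro Max_ge) auto
qed

text \<open>A pair that is not spread either fails to be positive, and then homogeneity puts every
  edge between its parts into \<open>R t\<close>, or it lies in one ball of radius 4, and a detour
  through the centre has length at most 8.\<close>

lemma edge_near_after_last_spread:
  assumes e: "{x, y} \<in> E" and t: "last_spread x y < t" "t \<le> m"
  shows "y \<in> rball t 8 x"
proof -
  have tm: "t \<in> {1..m}" using t by auto
  have xy: "x \<in> V" "y \<in> V" "x \<noteq> y" using edge_in_V e by auto
  have "\<not> spread_pair t (part t x) (part t y)" using last_spread(3)[OF e tm] t by auto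
  then consider "\<not> positive_pair t (part t x) (part t y)"
    | z where "z \<in> V" "part t x \<union> part t y \<subseteq> rball t 4 z"
    by (auto simp: spread_pair_def)
  then show ?thesis
  proof cases
    case 1
    then have "{x, y} \<in> R t"
      using homogeneous[OF tm] part_in_P[OF tm] part_self[OF tm] xy e
      unfolding homogeneous_mod_def positive_pair_def by meson
    then have "y \<in> rball t 1 x" using graph_ball_edge xy by auto
    then show ?thesis using graph_ball_mono[of "R t" "R t" 1 8 V x] by auto
  next
    case 2
    then have "x \<in> rball t 4 z" "y \<in> rball t 4 z" using part_self[OF tm] xy by auto
    then have "y \<in> rball t (4 + 4) x" using graph_ball_sym graph_ball_trans 2(1) by metis
    then show ?thesis by simp
  qed
qed

text \<open>Vertices in a common part at time \<open>t\<close> stay together later, so from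
  \<open>t\<close> on the two edges are spread at exactly the same times, and their last spread
  times coincide.\<close>

lemma label_cong:
  assumes e: "{x, y} \<in> E" "{x', y'} \<in> E"
    and t: "1 \<le> t" "t \<le> last_spread x y"
    and eq: "part t x = part t x'" "part t y = part t y'"
  shows "label x y = label x' y'"
proof -
  have V: "x \<in> V" "y \<in> V" "x' \<in> V" "y' \<in> V" using edge_in_V e by auto
  have eq': "part t' x = part t' x' \<and> part t' y = part t' y'" if "t \<le> t'" "t' \<le> m" for t'
    using part_mono[of t t' x x'] part_mono[of t t' y y'] V eq t(1) that by auto
  note ls = last_spread[OF e(1)] and ls' = last_spread[OF e(2)]
  have le: "last_spread x y \<le> last_spread x' y'"
    using ls(1,2) eq'[of "last_spread x y"] t by (intro ls'(3)) auto
  have "last_spread x' y' \<le> last_spread x y"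
    using ls'(1,2) eq'[of "last_spread x' y'"] t le by (intro ls(3)) auto
  then have "last_spread x y = last_spread x' y'" using le by simp
  then show ?thesis
    using eq'[of "last_spread x y"] t ls(1) by (simp add: label_def)
qed

section \<open>Two centres for the edges of a spread pair\<close>

lemma positive_pair_far_adjacent:
  assumes "positive_pair t X Y" "x \<in> X" "y \<in> Y" "X \<subseteq> V" "Y \<subseteq> V" "y \<notin> rball t 1 x"
  shows "{x, y} \<in> E"
  using assms graph_ball_self graph_ball_edge unfolding positive_pair_def by (metis subsetD)

text \<open>If some \<open>a\<close> in \<open>X\<close> has no vertex of \<open>Y\<close> in its
  \<open>R t\<close>-ball of radius 1, then \<open>a\<close> is adjacent to all of \<open>Y\<close>
  and serves as the only centre. Otherwise every vertex of \<open>X\<close> has a partner in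
  \<open>Y\<close> within one step. Let \<open>b\<close> be the partner of some \<open>a\<close>; a
  vertex outside the 4-ball of \<open>a\<close>, or its partner, gives \<open>b'\<close> in
  \<open>Y\<close> outside the 3-ball. No \<open>x\<close> in \<open>X\<close> is within one step of
  both \<open>b\<close> and \<open>b'\<close>, as \<open>a\<close>, \<open>b\<close>,
  \<open>x\<close>, \<open>b'\<close> would be too short a walk, so \<open>x\<close> is adjacent in
  \<open>E\<close> to one of them.\<close>

lemma spread_pair_centres:
  assumes sp: "spread_pair t X Y" and V: "X \<subseteq> V" "Y \<subseteq> V"
  shows "\<exists>p q. \<forall>x\<in>X. \<forall>y\<in>Y. {x, y} \<in> E \<longrightarrow>
           (p \<in> V \<and> x \<in> graph_ball V E 2 p) \<or> (q \<in> V \<and> x \<in> graph_ball V E 2 q)"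
proof -
  have pos: "positive_pair t X Y"
    and spread: "\<And>z. z \<in> V \<Longrightarrow> \<not> X \<union> Y \<subseteq> rball t 4 z"
    using sp by (auto simp: spread_pair_def)
  note adj = positive_pair_far_adjacent[OF pos _ _ V]
  have two: "x \<in> graph_ball V E 2 p" if "{p, y} \<in> E" "{y, x} \<in> E" for p x y
    using graph_ball_trans[of y V E 1 p x 1] graph_ball_edge edge_in_V that
    by (metis one_add_one)
  show ?thesis
  proof (cases "\<exists>a\<in>X. Y \<inter> rball t 1 a = {}")
    case True
    then obtain a where "a \<in> X" "\<And>y. y \<in> Y \<Longrightarrow> {a, y} \<in> E" using adj by blast
    then have "x \<in> graph_ball V E 2 a" "a \<in> V" if "y \<in> Y" "{x, y} \<in> E" for x y
      using two[of a y x] that V by (auto simp: insert_commute[of y x])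
    then show ?thesis by blast
  next
    case False
    then have partner: "\<exists>y\<in>Y. y \<in> rball t 1 x" if "x \<in> X" for x using that by blast
    show ?thesis
    proof (cases "X = {}")
      case False
      then obtain a where a: "a \<in> X" by blast
      then obtain b where b: "b \<in> Y" "b \<in> rball t 1 a" using partner by blast
      obtain c where c: "c \<in> X \<union> Y" "c \<notin> rball t 4 a" using spread a V by blast
      have "\<exists>b'\<in>Y. b' \<notin> rball t 3 a"
      proof (cases "c \<in> Y")
        case True
        then show ?thesis using c graph_ball_mono[of "R t" "R t" 3 4 V a] by auto
      next
        case False
        then obtain b' where b': "b' \<in> Y" "b' \<in> rball t 1 c" using c partner by blast
        then have "b' \<notin> rball t 3 a"
          using graph_ball_trans[of b' V "R t" 3 a c 1] graph_ball_sym[of b' V "R t" 1 c] c V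
          by auto
        then show ?thesis using b' by blast
      qed
      then obtain b' where b': "b' \<in> Y" "b' \<notin> rball t 3 a" by blast
      have "{x, b} \<in> E \<or> {x, b'} \<in> E" if x: "x \<in> X" for x
      proof (rule ccontr)
        assume "\<not> ({x, b} \<in> E \<or> {x, b'} \<in> E)"
        then have bb': "b \<in> rball t 1 x" "b' \<in> rball t 1 x"
          using adj[OF x b(1)] adj[OF x b'(1)] by blast+
        have "x \<in> rball t 1 b" using graph_ball_sym[OF bb'(1)] x V by auto
        from graph_ball_trans[OF graph_ball_trans[OF b(2) this] bb'(2)]
        show False using b'(2) by (simp add: numeral_3_eq_3)
      qed
      then have "{b, x} \<in> E \<or> {b', x} \<in> E" if "x \<in> X" for x
        using that by (metis insert_commute)
      then have "x \<in> graph_ball V E 1 b \<or> x \<in> graph_ball V E 1 b'" if "x \<in> X" for x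
        using that graph_ball_edge[of _ x E V] V by blast
      then have "x \<in> graph_ball V E 2 b \<or> x \<in> graph_ball V E 2 b'" if "x \<in> X" for x
        using that graph_ball_mono[of E E 1 2 V b] graph_ball_mono[of E E 1 2 V b'] by auto
      then show ?thesis using b(1) b'(1) V by blast
    qed simp
  qed
qed

section \<open>Choosing a label for each vertex\<close>

definition labels :: "'a \<Rightarrow> (nat \<times> 'a set \<times> 'a set) set" where
  "labels v = {label x y | x y. {v, x} \<in> E \<and> {x, y} \<in> E}"

text \<open>
  The second conjunct records that ties are broken by one linear order on all labels.
\<close>

definition maximal_labelling :: "('a \<Rightarrow> nat \<times> 'a set \<times> 'a set) \<Rightarrow> bool" where
  "maximal_labelling lab \<longleftrightarrow>
     (\<forall>v. nbhd E v \<noteq> {} \<longrightarrow> lab v \<in> labels v \<and> (\<forall>L\<in>labels v. fst L \<le> fst (lab v))) \<and>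
     (\<forall>v v'. lab v \<in> labels v' \<and> lab v' \<in> labels v \<longrightarrow> lab v = lab v')"

text \<open>Each vertex takes its label of largest rank, for an injective rank that refines the
  label time. If two vertices could each take the label of the other, the two ranks bound each other
  and the labels agree.\<close>

lemma maximal_labelling_exists: "\<exists>lab. maximal_labelling lab"
proof -
  define S where "S = (\<lambda>(x, y). label x y) ` (V \<times> V)"
  have "finite S" unfolding S_def using finite_V by simp
  then obtain rank :: "_ \<Rightarrow> nat" where rank: "inj_on rank S"
      "\<And>a b. a \<in> S \<Longrightarrow> b \<in> S \<Longrightarrow> rank a \<le> rank b \<Longrightarrow> fst a \<le> fst b"
    using exists_injective_rank_refining[of S fst] by blast
  have sub: "labels v \<subseteq> S" for v
    using edge_in_V by (force simp: labels_def S_def)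
  define lab where "lab v = arg_max rank (\<lambda>L. L \<in> labels v)" for v
  have bounded: "rank L < Suc (Max (rank ` S))" if "L \<in> S" for L
    using that \<open>finite S\<close> by (simp add: le_imp_less_Suc)
  have max: "lab v \<in> labels v \<and> (\<forall>L\<in>labels v. rank L \<le> rank (lab v))"
    if "L0 \<in> labels v" for v L0
  proof -
    have "\<forall>L. L \<in> labels v \<longrightarrow> rank L < Suc (Max (rank ` S))" using bounded sub by blast
    from arg_max_nat_lemma[of "\<lambda>L. L \<in> labels v", OF that this]
    show ?thesis unfolding lab_def by blast
  qed
  \<comment> \<open>The edge from \<open>v\<close> to \<open>x\<close> walked back supplies a label:
    \<open>y\<close> may be \<open>v\<close> itself.\<close>
  have nonempty: "\<exists>L. L \<in> labels v" if ne: "nbhd E v \<noteq> {}" for v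
  proof -
    obtain x where "{v, x} \<in> E" using ne by (auto simp: nbhd_def)
    then have "{v, x} \<in> E \<and> {x, v} \<in> E" by (simp add: insert_commute)
    then have "label x v \<in> labels v" unfolding labels_def by blast
    then show ?thesis by blast
  qed
  have "lab v \<in> labels v \<and> (\<forall>L\<in>labels v. fst L \<le> fst (lab v))" if "nbhd E v \<noteq> {}" for v
    using nonempty[OF that] max rank(2) sub by blast
  moreover have "lab v = lab v'" if "lab v \<in> labels v'" "lab v' \<in> labels v" for v v'
    using max[OF that(1)] max[OF that(2)] that rank(1) sub
    by (meson inj_onD le_antisym subsetD)
  ultimately have "maximal_labelling lab" unfolding maximal_labelling_def by blast
  then show ?thesis by blast
qed

section \<open>Counting the labels chosen around a vertex\<close>

text \<open>A vertex outside radius \<open>r + 1\<close> has no \<open>R (t + 1)\<close>-edge, hence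
  no \<open>R t\<close>-edge, to the ball of radius \<open>r\<close>. Homogeneity at time
  \<open>t\<close> then transfers adjacency within a part. Balls at \<open>t + 1\<close> against
  parts at \<open>t\<close> match the definition of width.\<close>

lemma same_part_far_adjacent:
  assumes t: "t \<in> {1..<m}" and uv: "a \<in> V" "a' \<in> V"
    and near: "a \<in> rball (t + 1) r u" "a' \<in> rball (t + 1) r u"
    and far: "b \<notin> rball (t + 1) (r + 1) u"
    and e: "{a, b} \<in> E" and eq: "part t a = part t a'"
  shows "{a', b} \<in> E"
proof -
  have tm: "t \<in> {1..m}" using t by auto
  have b: "b \<in> V" using edge_in_V e by blast
  have "{c, b} \<notin> R t \<and> c \<noteq> b" if "c \<in> rball (t + 1) r u" for c
  proof -
    have "b \<notin> rball (t + 1) 1 c" using graph_ball_trans[OF that] far by blast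
    moreover have "R t \<subseteq> R (t + 1)" using R_mono[of t "t + 1"] t by auto
    ultimately show ?thesis
      using graph_ball_edge[of c b "R (t + 1)" V] graph_ball_self[OF b] b by blast
  qed
  then have "a \<noteq> b" "a' \<noteq> b" "{a, b} \<notin> R t" "{a', b} \<notin> R t" using near by auto
  moreover have "a \<in> part t a" "a' \<in> part t a" "b \<in> part t b"
    "part t a \<in> P t" "part t b \<in> P t"
    using part_self[OF tm] part_in_P[OF tm] eq b uv by auto
  ultimately show ?thesis
    using homogeneous[OF tm] e unfolding homogeneous_mod_def by meson
qed

lemma k_pos:
  assumes "v \<in> V" "2 \<le> m"
  shows "1 \<le> k"
proof -
  have m: "1 \<in> {1..m}" "1 \<in> {1..<m}" using assms by auto
  let ?S = "parts_meeting (rball (1 + 1) 17 v) (P 1)"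
  have "part 1 v \<in> ?S"
    using part_in_P[OF m(1)] part_self[OF m(1)] graph_ball_self assms
    by (fastforce simp: parts_meeting_def)
  moreover have "finite ?S" unfolding parts_meeting_def P_1 using finite_V by simp
  ultimately have "card ?S \<noteq> 0" by auto
  then show ?thesis using width[OF m(2) assms(1)] by linarith
qed

text \<open>The three cases contribute at most \<open>k - 1\<close> labels (far \<open>x\<close>),
  \<open>k\<close> labels (near \<open>x\<close>, far \<open>y\<close>) and \<open>k * k\<close>
  labels (both near).\<close>

lemma card_labels_of_nbhd:
  assumes lab: "maximal_labelling lab" and u: "u \<in> V" and m2: "2 \<le> m"
  shows "finite (lab ` nbhd E u) \<and> card (lab ` nbhd E u) \<le> 2 * k\<^sup>2"
proof (cases "nbhd E u = {}")
  case False
  let ?N = "nbhd E u"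
  have k1: "1 \<le> k" using k_pos[OF u m2] .
  have NV: "v \<in> V" "{v, u} \<in> E" "{u, v} \<in> E" if "v \<in> ?N" for v
    using that edge_in_V[of u v] insert_commute[of u v] by (auto simp: nbhd_def)
  have finN: "finite ?N" using NV finite_V by (meson finite_subset subsetI)
  have ne: "nbhd E v \<noteq> {}" if "v \<in> ?N" for v using NV[OF that] by (auto simp: nbhd_def)
  have labv: "lab v \<in> labels v" "\<And>L. L \<in> labels v \<Longrightarrow> fst L \<le> fst (lab v)" if "v \<in> ?N" for v
    using lab ne[OF that] unfolding maximal_labelling_def by blast+
  have lab_eq: "lab v = lab v'" if "lab v \<in> labels v'" "lab v' \<in> labels v" for v v'
    using lab that unfolding maximal_labelling_def by blast
  have "\<forall>v\<in>?N. \<exists>x y. {v, x} \<in> E \<and> {x, y} \<in> E \<and> lab v = label x y"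
    using labv(1) unfolding labels_def by blast
  then obtain x y where xy:
    "\<And>v. v \<in> ?N \<Longrightarrow> {v, x v} \<in> E" "\<And>v. v \<in> ?N \<Longrightarrow> {x v, y v} \<in> E"
    "\<And>v. v \<in> ?N \<Longrightarrow> lab v = label (x v) (y v)"
    by metis
  have xyV: "x v \<in> V" "y v \<in> V" if "v \<in> ?N" for v using edge_in_V xy(2)[OF that] by auto
  define s where "s = Min ((\<lambda>v. fst (lab v)) ` ?N)"
  have s_le: "s \<le> fst (lab v)" if "v \<in> ?N" for v using that finN by (simp add: s_def)
  obtain v1 where v1: "v1 \<in> ?N" "fst (lab v1) = s"
    using Min_in[of "(\<lambda>v. fst (lab v)) ` ?N"] finN False unfolding s_def
    by (metis (no_types, lifting) finite_imageI image_iff image_is_empty)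
  have fst_lab: "fst (lab v) = last_spread (x v) (y v)" if "v \<in> ?N" for v
    using xy(3)[OF that] by (simp add: label_def)
  have range: "fst (lab v) \<in> {1..m}" if "v \<in> ?N" for v
    using fst_lab[OF that] last_spread(1)[OF xy(2)[OF that]] by simp
  have s: "1 \<le> s" "s \<le> m" using range[OF v1(1)] v1(2) by auto
  show ?thesis
  \<comment> \<open>For \<open>s = m\<close> there is no time \<open>s + 1\<close>, but then every
    chosen label is that of the one-part partition.\<close>
  proof (cases "s = m")
    case True
    have "lab v = (m, V, V)" if "v \<in> ?N" for v
    proof -
      have "last_spread (x v) (y v) = m"
        using s_le[OF that] range[OF that] True fst_lab[OF that] by auto
      moreover have "part m z = V" if "z \<in> V" for z
        using that m_pos P_m by (intro part_eqI) auto
      ultimately show ?thesis using xyV[OF that] xy(3)[OF that] by (simp add: label_def)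
    qed
    then have "lab ` ?N \<subseteq> {(m, V, V)}" by auto
    then have "finite (lab ` ?N)" "card (lab ` ?N) \<le> 1"
      using finN card_mono[of "{(m, V, V)}" "lab ` ?N"] by auto
    moreover have "1 \<le> 2 * k\<^sup>2" using k1 by simp
    ultimately show ?thesis by linarith
  next
    case False
    then have sm: "s \<in> {1..<m}" "s \<in> {1..m}" using s by auto
    let ?B = "\<lambda>r. rball (s + 1) r u"
    have B_mono: "?B r \<subseteq> ?B r'" if "r \<le> r'" for r r' using that by (intro graph_ball_mono) auto
    \<comment> \<open>The label of \<open>v1\<close> is the latest in \<open>labels v1\<close> and
      has time \<open>s\<close>, so every edge at a neighbour of \<open>v1\<close> is past its last
      spread time at \<open>s + 1\<close>.\<close>
    have near: "b \<in> rball (s + 1) 8 a" if "{v1, a} \<in> E" "{a, b} \<in> E" for a b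
    proof -
      have "label a b \<in> labels v1" using that by (auto simp: labels_def)
      then have "last_spread a b \<le> s" using labv(2)[OF v1(1)] v1(2) by (fastforce simp: label_def)
      then show ?thesis using edge_near_after_last_spread[OF that(2)] sm by auto
    qed
    \<comment> \<open>Here \<open>a = u\<close>, which is a neighbour of \<open>v1\<close>.\<close>
    have nearN: "v \<in> ?B 8" if "v \<in> ?N" for v
      using near NV(2)[OF v1(1)] NV(3)[OF that] by blast
    \<comment> \<open>From \<open>u\<close> to \<open>v1\<close> and from \<open>v1\<close> to
      \<open>a\<close> the distance is at most 8 each.\<close>
    have near_v1: "a \<in> ?B 16" if "{v1, a} \<in> E" for a
    proof -
      have "v1 \<in> rball (s + 1) 8 a" using near[OF that] that insert_commute[of v1 a] by auto
      then have "a \<in> rball (s + 1) 8 v1"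
        using graph_ball_sym[of v1 V _ 8 a] edge_in_V[OF that] by blast
      from graph_ball_trans[OF nearN[OF v1(1)] this] show ?thesis by simp
    qed
    define C where "C = parts_meeting (?B 17) (P s)"
    have "finite (P s)" using partition[OF sm(2)] finite_V finite_elements by blast
    then have finC: "finite C" by (simp add: C_def parts_meeting_def)
    have cardC: "card C \<le> k" unfolding C_def using width[OF sm(1) u] .
    have part_C: "part s z \<in> C" if "z \<in> ?B 17" for z
    proof -
      have "z \<in> V" using that by (simp add: graph_ball_def)
      then show ?thesis
        using that part_in_P[OF sm(2)] part_self[OF sm(2)] by (auto simp: C_def parts_meeting_def)
    qed
    \<comment> \<open>The cut for \<open>x\<close> must exceed 8 to allow the transfer within the
      part of \<open>v\<close>, and it is 16 so that no neighbour of \<open>v1\<close> counts as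
      far. The cut for \<open>y\<close> adds the one-step margin.\<close>
    define F where "F = {v \<in> ?N. x v \<notin> ?B 16}"
    define NF where "NF = {v \<in> ?N. x v \<in> ?B 16 \<and> y v \<notin> ?B 17}"
    define NN where "NN = {v \<in> ?N. x v \<in> ?B 16 \<and> y v \<in> ?B 17}"
    have adjF: "{v', x v} \<in> E" if "v \<in> F" "v' \<in> ?N" "part s v = part s v'" for v v'
    proof -
      have v: "v \<in> ?N" "x v \<notin> ?B (8 + 1)" using that(1) B_mono[of 9 16] by (auto simp: F_def)
      show ?thesis
        using same_part_far_adjacent[OF sm(1) _ _ nearN[OF v(1)] nearN[OF that(2)] v(2)]
          NV(1)[OF v(1)] NV(1)[OF that(2)] xy(1)[OF v(1)] that(3) by blast
    qed
    \<comment> \<open>The part of \<open>v1\<close> is excluded: saving this one class gives \<open>2k\<^sup>2\<close> also for \<open>k = 1\<close>.\<close>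
    have F: "finite (lab ` F) \<and> card (lab ` F) \<le> card (C - {part s v1})"
    proof (rule card_image_le_card_classes[where g = "part s"])
      show "part s ` F \<subseteq> C - {part s v1}"
      proof (rule image_subsetI)
        fix v assume v: "v \<in> F"
        then have "v \<in> ?B 17" using nearN B_mono[of 8 17] by (auto simp: F_def)
        moreover have "part s v \<noteq> part s v1"
          using near_v1 adjF[OF v v1(1)] v by (auto simp: F_def)
        ultimately show "part s v \<in> C - {part s v1}" using part_C by blast
      qed
      fix v v' assume vv': "v \<in> F" "v' \<in> F" "part s v = part s v'"
      then have N: "v \<in> ?N" "v' \<in> ?N" by (auto simp: F_def)
      \<comment> \<open>Each of \<open>v\<close>, \<open>v'\<close> is adjacent to the far vertex
        chosen by the other, so both labels were available to both and tie-breaking makes them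
        equal.\<close>
      have "{v', x v} \<in> E" "{v, x v'} \<in> E" using adjF vv' N by auto
      then have "label (x v) (y v) \<in> labels v'" "label (x v') (y v') \<in> labels v"
        using xy(2) N by (auto simp: labels_def)
      then show "lab v = lab v'"
        using lab_eq[of v v'] unfolding xy(3)[OF N(1)] xy(3)[OF N(2)] by blast
    qed (use finC in simp)
    have NF: "finite (lab ` NF) \<and> card (lab ` NF) \<le> card C"
    proof (rule card_image_le_card_classes[where g = "\<lambda>v. part s (x v)"])
      show "(\<lambda>v. part s (x v)) ` NF \<subseteq> C"
        using part_C B_mono[of 16 17] by (auto simp: NF_def)
      have *: "lab v \<in> labels v'" if "v \<in> NF" "v' \<in> NF" "part s (x v) = part s (x v')" for v v'
      proof -
        have v: "v \<in> ?N" "x v \<in> ?B 16" "y v \<notin> ?B (16 + 1)" and v': "v' \<in> ?N" "x v' \<in> ?B 16"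
          using that by (auto simp: NF_def)
        have e: "{x v', y v} \<in> E"
          using same_part_far_adjacent[OF sm(1) _ _ v(2) v'(2) v(3)] xyV v(1) v'(1)
            xy(2)[OF v(1)] that(3) by blast
        \<comment> \<open>Replacing \<open>x v\<close> by \<open>x v'\<close> keeps the parts at
          time \<open>s\<close>, which is no later than the label time, so the label of
          \<open>v\<close> is available to \<open>v'\<close> too.\<close>
        have "label (x v) (y v) = label (x v') (y v)"
          using label_cong[OF xy(2)[OF v(1)] e s(1)] s_le[OF v(1)] fst_lab[OF v(1)] that(3) by simp
        then show ?thesis using xy(1)[OF v'(1)] xy(3)[OF v(1)] e by (auto simp: labels_def)
      qed
      fix v v' assume "v \<in> NF" "v' \<in> NF" "part s (x v) = part s (x v')"
      then show "lab v = lab v'" using * lab_eq by simp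
    qed (use finC in simp)
    have NN: "finite (lab ` NN) \<and> card (lab ` NN) \<le> card (C \<times> C)"
    proof (rule card_image_le_card_classes[where g = "\<lambda>v. (part s (x v), part s (y v))"])
      show "(\<lambda>v. (part s (x v), part s (y v))) ` NN \<subseteq> C \<times> C"
        using part_C B_mono[of 16 17] by (auto simp: NN_def)
      fix v v' assume vv': "v \<in> NN" "v' \<in> NN"
        "(part s (x v), part s (y v)) = (part s (x v'), part s (y v'))"
      then have N: "v \<in> ?N" "v' \<in> ?N" by (auto simp: NN_def)
      show "lab v = lab v'"
        using label_cong[OF xy(2)[OF N(1)] xy(2)[OF N(2)] s(1)] s_le[OF N(1)] fst_lab[OF N(1)]
          vv'(3) xy(3) N by simp
    qed (use finC in simp)
    have "part s v1 \<in> C" using part_C nearN[OF v1(1)] B_mono[of 8 17] by auto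
    then have "card (C - {part s v1}) \<le> k - 1" using cardC finC by simp
    moreover have "card (C \<times> C) \<le> k * k" using cardC by (simp add: card_cartesian_product mult_mono)
    moreover have split: "lab ` ?N = lab ` F \<union> (lab ` NF \<union> lab ` NN)"
      by (auto simp: F_def NF_def NN_def)
    moreover have "card (lab ` F \<union> (lab ` NF \<union> lab ` NN))
        \<le> card (lab ` F) + (card (lab ` NF) + card (lab ` NN))"
      by (meson add_left_mono card_Un_le order_trans)
    ultimately have "card (lab ` ?N) \<le> (k - 1) + (k + k * k)"
      using F NF NN cardC unfolding split by linarith
    \<comment> \<open>This is \<open>2 * k - 1 <= k * k\<close>, that is, the square of
      \<open>k - 1\<close> is non-negative.\<close>
    also have "\<dots> \<le> 2 * k\<^sup>2"
    proof -
      obtain j where "k = Suc j" using k1 by (cases k) auto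
      then show ?thesis by (simp add: power2_eq_square)
    qed
    finally show ?thesis using F NF NN split by simp
  qed
qed simp

section \<open>Clusters and their overlap\<close>

lemma label_centres:
  "\<exists>p q. \<forall>x y. {x, y} \<in> E \<and> label x y = L \<longrightarrow>
     (p \<in> V \<and> x \<in> graph_ball V E 2 p) \<or> (q \<in> V \<and> x \<in> graph_ball V E 2 q)"
proof (cases "\<exists>x0 y0. {x0, y0} \<in> E \<and> label x0 y0 = L")
  case True
  then obtain x0 y0 where 0: "{x0, y0} \<in> E" "label x0 y0 = L" by blast
  obtain t X Y where L: "L = (t, X, Y)" by (cases L)
  have sp: "spread_pair t X Y" "t \<in> {1..m}" "X \<subseteq> V" "Y \<subseteq> V"
    using last_spread(1,2)[OF 0(1)] 0(2) L part_subset by (auto simp: label_def)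
  obtain p q where pq: "\<And>x y. x \<in> X \<Longrightarrow> y \<in> Y \<Longrightarrow> {x, y} \<in> E \<Longrightarrow>
      (p \<in> V \<and> x \<in> graph_ball V E 2 p) \<or> (q \<in> V \<and> x \<in> graph_ball V E 2 q)"
    using spread_pair_centres[OF sp(1,3,4)] by blast
  have "x \<in> X \<and> y \<in> Y" if "{x, y} \<in> E" "label x y = L" for x y
    using that part_self[OF sp(2)] edge_in_V[OF that(1)] L by (auto simp: label_def)
  then show ?thesis using pq by blast
qed blast

text \<open>The radius is 4 = 2 + 1 + 1: from the centre to \<open>x\<close>, on to
  \<open>v\<close>, and on to the neighbours of \<open>v\<close>. A cluster contains
  \<open>u\<close> only if its key belongs to some \<open>v\<close> in \<open>N(u)\<close>; at most
  \<open>2 * k * k\<close> labels with two candidate centres each give the overlap.\<close>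

lemma neighbourhood_cover_exists:
  assumes "E \<noteq> {}" and m2: "2 \<le> m"
  shows "\<exists>K. neighbourhood_cover V E (4 * k\<^sup>2) 4 K"
proof -
  obtain lab where lab: "maximal_labelling lab" using maximal_labelling_exists by blast
  obtain p q where pq: "\<And>L x y. {x, y} \<in> E \<Longrightarrow> label x y = L \<Longrightarrow>
      (p L \<in> V \<and> x \<in> graph_ball V E 2 (p L)) \<or> (q L \<in> V \<and> x \<in> graph_ball V E 2 (q L))"
    using label_centres by metis
  define W where "W = {v \<in> V. nbhd E v \<noteq> {}}"
  have "\<exists>c\<in>V. c \<in> {p (lab v), q (lab v)} \<and> nbhd E v \<subseteq> graph_ball V E 4 c" if "v \<in> W" for v
  proof -
    have "lab v \<in> labels v" using that lab by (auto simp: W_def maximal_labelling_def)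
    then obtain x y where xy: "{v, x} \<in> E" "{x, y} \<in> E" "label x y = lab v"
      by (auto simp: labels_def)
    then obtain c where c: "c \<in> V" "c \<in> {p (lab v), q (lab v)}" "x \<in> graph_ball V E 2 c"
      using pq by blast
    have "w \<in> graph_ball V E 4 c" if "{v, w} \<in> E" for w
    proof -
      have "v \<in> graph_ball V E 1 x" "w \<in> graph_ball V E 1 v"
        using graph_ball_edge[of x v E V] graph_ball_edge[of v w E V] edge_in_V xy(1) that
          insert_commute[of v x] by auto
      from graph_ball_trans[OF graph_ball_trans[OF c(3) this(1)] this(2)]
      show ?thesis by simp
    qed
    then show ?thesis using c by (auto simp: nbhd_def)
  qed
  then obtain cen where cen: "\<And>v. v \<in> W \<Longrightarrow> cen v \<in> V"
    "\<And>v. v \<in> W \<Longrightarrow> cen v \<in> {p (lab v), q (lab v)}"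
    "\<And>v. v \<in> W \<Longrightarrow> nbhd E v \<subseteq> graph_ball V E 4 (cen v)"
    by metis
  define key where "key v = (lab v, cen v)" for v
  define cl where "cl \<kappa> = \<Union>{nbhd E v | v. v \<in> W \<and> key v = \<kappa>}" for \<kappa>
  define K where "K = cl ` key ` W"
  have nbhd_cl: "nbhd E v \<subseteq> cl (key v)" if "v \<in> W" for v using that by (auto simp: cl_def)
  have nbhd_V: "nbhd E v \<subseteq> V" for v using edge_in_V by (auto simp: nbhd_def)
  \<comment> \<open>An edge makes \<open>K\<close> non-empty, so the empty neighbourhood of an
    isolated vertex also lies in some cluster.\<close>
  obtain e where e: "e \<in> E" using assms by blast
  then have "card e = 2" using graph by (auto simp: finite_graph_def nsets_def)
  then obtain a b where "e = {a, b}" by (meson card_2_iff)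
  then have aW: "a \<in> W" using e edge_in_V by (auto simp: W_def nbhd_def)
  have "neighbourhood_cover V E (4 * k\<^sup>2) 4 K"
    unfolding neighbourhood_cover_def
  proof (intro conjI ballI)
    fix C assume "C \<in> K"
    then obtain v where v: "v \<in> W" "C = cl (key v)" by (auto simp: K_def)
    then show "C \<noteq> {}" using nbhd_cl[OF v(1)] by (auto simp: W_def)
    show "C \<subseteq> V" using nbhd_V v by (auto simp: cl_def)
    have "C \<subseteq> graph_ball V E 4 (cen v)"
      using v cen(3) by (fastforce simp: cl_def key_def)
    then show "\<exists>v\<in>V. C \<subseteq> graph_ball V E 4 v" using cen(1)[OF v(1)] by blast
  next
    fix v assume "v \<in> V"
    show "\<exists>C\<in>K. nbhd E v \<subseteq> C"
    proof (cases "v \<in> W")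
      case True
      then show ?thesis using nbhd_cl by (auto simp: K_def)
    next
      case False
      then have "nbhd E v = {}" using \<open>v \<in> V\<close> by (simp add: W_def)
      then show ?thesis using aW by (auto simp: K_def)
    qed
  next
    fix u assume u: "u \<in> V"
    let ?N = "nbhd E u"
    have NW: "?N \<subseteq> W"
    proof
      fix v assume "v \<in> ?N"
      then have "v \<in> V" "u \<in> nbhd E v"
        using nbhd_V[of u] by (auto simp: nbhd_def insert_commute)
      then show "v \<in> W" by (auto simp: W_def)
    qed
    have fin: "finite (lab ` ?N)" and card: "card (lab ` ?N) \<le> 2 * k\<^sup>2"
      using card_labels_of_nbhd[OF lab u m2] by auto
    have "{C \<in> K. u \<in> C} \<subseteq> cl ` key ` ?N"
    proof
      fix C assume "C \<in> {C \<in> K. u \<in> C}"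
      then obtain v where "v \<in> W" "u \<in> cl (key v)" "C = cl (key v)" by (auto simp: K_def)
      then obtain v' where "u \<in> nbhd E v'" "C = cl (key v')" by (auto simp: cl_def)
      then show "C \<in> cl ` key ` ?N" by (auto simp: nbhd_def insert_commute)
    qed
    also have "\<dots> \<subseteq> cl ` ((\<lambda>L. (L, p L)) ` lab ` ?N \<union> (\<lambda>L. (L, q L)) ` lab ` ?N)"
      using cen(2) NW by (fastforce simp: key_def)
    finally have "card {C \<in> K. u \<in> C}
        \<le> card (cl ` ((\<lambda>L. (L, p L)) ` lab ` ?N \<union> (\<lambda>L. (L, q L)) ` lab ` ?N))"
      using fin by (intro card_mono) auto
    also have "\<dots> \<le> card ((\<lambda>L. (L, p L)) ` lab ` ?N \<union> (\<lambda>L. (L, q L)) ` lab ` ?N)"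
      using fin by (intro card_image_le) auto
    also have "\<dots> \<le> card ((\<lambda>L. (L, p L)) ` lab ` ?N) + card ((\<lambda>L. (L, q L)) ` lab ` ?N)"
      by (rule card_Un_le)
    also have "\<dots> \<le> card (lab ` ?N) + card (lab ` ?N)"
      using fin by (intro add_mono card_image_le)
    finally show "card {C \<in> K. u \<in> C} \<le> 4 * k\<^sup>2" using card by simp
  qed
  then show ?thesis by blast
qed

end

section \<open>From the merge sequence to the stated constants\<close>

text \<open>\<open>R 1\<close> does not enter the width; clearing it makes every edge spread at time 1.\<close>

lemma merge_sequence_clear_first:
  assumes "merge_sequence V E m P R"
  shows "merge_sequence V E m P (R(1 := {}))"
proof -
  have "homogeneous_mod E {} (P 1)"
    using assms by (auto simp: merge_sequence_def homogeneous_mod_def)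
  then show ?thesis using assms by (auto simp: merge_sequence_def)
qed

lemma nbhd_complexity_ge:
  assumes "finite V" "A \<subseteq> V" "card A \<le> n"
  shows "card ((\<lambda>v. nbhd E v \<inter> A) ` V) \<le> nbhd_complexity V E n"
  unfolding nbhd_complexity_def using assms by (intro Max_ge) auto

lemma neighbourhood_cover_mono:
  assumes "neighbourhood_cover V E k t K" "k \<le> k'" "t \<le> t'"
  shows "neighbourhood_cover V E k' t' K"
proof -
  have "graph_ball V E t v \<subseteq> graph_ball V E t' v" for v
    using assms(3) by (intro graph_ball_mono) auto
  then show ?thesis
    using assms(1,2) unfolding neighbourhood_cover_def by (meson order_trans)
qed

theorem theorem8p6:
  fixes V :: "'a set" and E :: "'a set set" and k l :: nat
  assumes "finite_graph V E"
    and "k = merge_width 37 V E"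
    and "l = k * nbhd_complexity V E k"
  shows "\<exists>K. neighbourhood_cover V E (l ^ 2) 38 K"
proof (cases "V = {}")
  case True
  then have "neighbourhood_cover V E (l ^ 2) 38 {}" by (simp add: neighbourhood_cover_def)
  then show ?thesis by blast
next
  case False
  then obtain v0 where v0: "v0 \<in> V" by blast
  have finV: "finite V" using assms(1) by (simp add: finite_graph_def)
  obtain m P R where seq: "merge_sequence V E m P R" and m2: "2 \<le> m"
    and w: "merge_sequence_width V 37 m P R = k"
    using merge_width_attained[OF False] assms(2) by blast
  \<comment> \<open>Since \<open>t + 1\<close> is at least 2, clearing \<open>R 1\<close> leaves
    these balls unchanged, and the ball of radius 37 meets every part that the ball of radius 17
    meets.\<close>
  have width: "card (parts_meeting (graph_ball V ((R(1 := {})) (t + 1)) 17 v) (P t)) \<le> k"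
    if t: "t \<in> {1..<m}" and v: "v \<in> V" for t v
  proof -
    have "partition_on V (P t)" using seq t by (auto simp: merge_sequence_def)
    then have "finite (P t)" using finV finite_elements by blast
    then have "card (parts_meeting (graph_ball V (R (t + 1)) 17 v) (P t))
        \<le> card (parts_meeting (graph_ball V (R (t + 1)) 37 v) (P t))"
      using graph_ball_mono[of "R (t + 1)" "R (t + 1)" 17 37 V v]
      by (intro card_mono) (auto simp: parts_meeting_def)
    also have "\<dots> \<le> k"
      unfolding w[symmetric] merge_sequence_width_def
      using t v finV by (intro Max_ge) (auto intro!: image_eqI[of _ _ "(t, v)"])
    finally show ?thesis using t by simp
  qed
  interpret graph_merge_sequence V E m k P "R(1 := {})"
    using assms(1) merge_sequence_clear_first[OF seq] width by unfold_locales auto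
  have k1: "1 \<le> k" using k_pos[OF v0 m2] .
  show ?thesis
  proof (cases "E = {}")
    case True
    \<comment> \<open>Without edges one singleton is a cover; the empty trace alone gives
      \<open>l >= 1\<close>, the overlap it needs.\<close>
    have "(\<lambda>v. nbhd E v \<inter> {}) ` V = {{}}" using v0 by auto
    then have "card ((\<lambda>v. nbhd E v \<inter> {}) ` V) = 1" by simp
    then have "1 \<le> nbhd_complexity V E k" using nbhd_complexity_ge[OF finV, of "{}" k E] by simp
    then have "1 \<le> l" using k1 assms(3) by simp
    then have "1 \<le> l ^ 2" by simp
    moreover have "card {C \<in> {{v0}}. v \<in> C} \<le> 1" for v
      using card_mono[of "{{v0}}" "{C \<in> {{v0}}. v \<in> C}"] by auto
    ultimately have "card {C \<in> {{v0}}. v \<in> C} \<le> l ^ 2" for v by (meson order_trans)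
    then have "neighbourhood_cover V E (l ^ 2) 38 {{v0}}"
      using v0 True graph_ball_self[OF v0] unfolding neighbourhood_cover_def nbhd_def by blast
    then show ?thesis by blast
  next
    case False
    then obtain e where e: "e \<in> E" by blast
    then have "card e = 2" using assms(1) by (auto simp: finite_graph_def nsets_def)
    then obtain a b where "e = {a, b}" by (meson card_2_iff)
    then have ab: "{a, b} \<in> E" "a \<in> V" "b \<in> V" using e edge_in_V[of a b] by auto
    \<comment> \<open>The ends of an edge have different traces on \<open>{a}\<close>, a set of
      admissible size because \<open>k >= 1\<close>; this yields the factor 2 that turns
      \<open>4 * k * k\<close> into at most the square of \<open>l\<close>.\<close>
    have "a \<notin> nbhd E a" "a \<in> nbhd E b"
      using ab edge_in_V[of a a] insert_commute[of a b] by (auto simp: nbhd_def)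
    then have "nbhd E a \<inter> {a} = {}" "nbhd E b \<inter> {a} = {a}" by auto
    then have "{{}, {a}} \<subseteq> (\<lambda>v. nbhd E v \<inter> {a}) ` V" using ab by blast
    then have "card {{}, {a}} \<le> card ((\<lambda>v. nbhd E v \<inter> {a}) ` V)"
      using finV by (intro card_mono) auto
    then have "2 \<le> nbhd_complexity V E k"
      using nbhd_complexity_ge[OF finV, of "{a}" k E] ab k1 by auto
    then have "k * 2 \<le> l" unfolding assms(3) by (rule mult_le_mono2)
    then have "(k * 2)\<^sup>2 \<le> l\<^sup>2" by (rule power_mono) simp
    then have "4 * k\<^sup>2 \<le> l\<^sup>2" by (simp add: power_mult_distrib)
    then show ?thesis
      using neighbourhood_cover_exists[OF False m2] neighbourhood_cover_mono[of V E "4 * k\<^sup>2" 4 _ "l\<^sup>2" 38]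
      by auto
  qed
qed

end
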